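(* Let $(G,\le)$ be an arbitrary nilpotent, linearly ordered divisible group, and let $\mathcal{L}(G)$ be the rational Lie algebra corresponding to $G$ under the Malcev correspondence (on the same underlying set). Then $(\mathcal{L}(G),\le)$, with the same order $\le$, is a linearly ordered algebra over $\mathbb{Q}$.
   Context: A linearly ordered group is a group with a linear order such that $a\le b$ implies $ac\le bc$ and $ca\le cb$ for all $c$ (in particular it is torsion free). A group $G$ is divisible if for all $a\in G$, $n\ge1$ there is $x\in G$ with $x^n=a$. Malcev correspondence: for a nilpotent Lie algebra $L$ over $\mathbb{Q}$, the Baker–Campbell–Hausdorff operation $x\circ y=\log(\exp x\exp y)=x+y+\frac12(x,y)+\frac1{12}(x,(x,y))-\frac1{12}(y,(x,y))+\cdots$, where $(\cdot,\cdot)$ is the Lie bracket, makes the set $L$ a torsion free divisible nilpotent group. For a torsion free divisible nilpotent group $G$, $\mathcal{L}(G)$ is the unique rational nilpotent Lie algebra on the same underlying set whose Baker–Campbell–Hausdorff group is $G$, with scalar multiplication $qa=a^q$ ($q\in\mathbb{Q}$). A (partially, linearly) ordered algebra over a linearly ordered field $\mathbb{F}$ is an algebra $A$ with a (partial, linear) order making $A$ an ordered vector space (the order is compatible with addition and with multiplication by nonnegative scalars) such that $a>0$ implies $ab<a$ and $ba<a$ for all $b\in A$. *)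

theory Defs
  imports Complex_Main "HOL-Algebra.Module" "HOL-Algebra.Generated_Groups"
begin

section \<open>Groups\<close>

text \<open>An order on the carrier is a relation \<open>r\<close>, where \<open>(a, b) \<in> r\<close> means \<open>a \<le> b\<close>.\<close>

locale linearly_ordered_group = group G
  for G :: "('a, 'm) monoid_scheme" (structure) and r :: "'a rel" +
  assumes linear_order: "linear_order_on (carrier G) r"
    and mult_right_mono: "\<lbrakk>(a, b) \<in> r; c \<in> carrier G\<rbrakk> \<Longrightarrow> (a \<otimes> c, b \<otimes> c) \<in> r"
    and mult_left_mono: "\<lbrakk>(a, b) \<in> r; c \<in> carrier G\<rbrakk> \<Longrightarrow> (c \<otimes> a, c \<otimes> b) \<in> r"

locale divisible_group = group G for G (structure) +
  assumes divisible:
    "\<lbrakk>a \<in> carrier G; (n::nat) \<ge> 1\<rbrakk> \<Longrightarrow> \<exists>x\<in>carrier G. x [^] n = a"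

primrec group_lower_central :: "('a, 'm) monoid_scheme \<Rightarrow> nat \<Rightarrow> 'a set" where
  "group_lower_central G 0 = carrier G"
| "group_lower_central G (Suc n) = generate G
    {x \<otimes>\<^bsub>G\<^esub> y \<otimes>\<^bsub>G\<^esub> inv\<^bsub>G\<^esub> x \<otimes>\<^bsub>G\<^esub> inv\<^bsub>G\<^esub> y | x y.
      x \<in> carrier G \<and> y \<in> group_lower_central G n}"

locale nilpotent_group = group G for G (structure) +
  assumes nilpotent: "\<exists>n. group_lower_central G n = {\<one>}"

text \<open>
  \<open>a\<^sup>q\<close> for \<open>q = m / n\<close> in lowest terms is the \<open>n\<close>-th root of \<open>a\<^sup>m\<close>. Roots exist in divisible groups
  and are unique in torsion free nilpotent groups.
\<close>

definition rat_pow :: "('a, 'm) monoid_scheme \<Rightarrow> 'a \<Rightarrow> rat \<Rightarrow> 'a" where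
  "rat_pow G a q = (case quotient_of q of (m, n) \<Rightarrow>
     THE x. x \<in> carrier G \<and> x [^]\<^bsub>G\<^esub> n = a [^]\<^bsub>G\<^esub> m)"

section \<open>Algebras over a field\<close>

definition scalar_field :: "'k::field ring" where
  "scalar_field = \<lparr>carrier = UNIV, mult = (*), one = 1, zero = 0, add = (+)\<rparr>"

text \<open>
  Algebras are not assumed associative, commutative or unital. The product of two elements, which is
  the bracket for Lie algebras, is the \<open>mult\<close> field of the module record; its \<open>one\<close> field is not used.
\<close>

locale algebra_over_field = module scalar_field A
  for A :: "('k::field, 'a, 'm) module_scheme" (structure) +
  assumes prod_closed: "\<lbrakk>x \<in> carrier A; y \<in> carrier A\<rbrakk> \<Longrightarrow> x \<otimes> y \<in> carrier A"
    and prod_add_left: "\<lbrakk>x \<in> carrier A; y \<in> carrier A; z \<in> carrier A\<rbrakk> \<Longrightarrow>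
      (x \<oplus> y) \<otimes> z = (x \<otimes> z) \<oplus> (y \<otimes> z)"
    and prod_add_right: "\<lbrakk>x \<in> carrier A; y \<in> carrier A; z \<in> carrier A\<rbrakk> \<Longrightarrow>
      x \<otimes> (y \<oplus> z) = (x \<otimes> y) \<oplus> (x \<otimes> z)"
    and prod_smult_left: "\<lbrakk>x \<in> carrier A; y \<in> carrier A\<rbrakk> \<Longrightarrow>
      (q \<odot> x) \<otimes> y = q \<odot> (x \<otimes> y)"
    and prod_smult_right: "\<lbrakk>x \<in> carrier A; y \<in> carrier A\<rbrakk> \<Longrightarrow>
      x \<otimes> (q \<odot> y) = q \<odot> (x \<otimes> y)"

locale linearly_ordered_algebra = algebra_over_field A
  for A :: "('k::linordered_field, 'a, 'm) module_scheme" (structure) and r :: "'a rel" +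
  assumes linear_order: "linear_order_on (carrier A) r"
    and add_mono: "\<lbrakk>(a, b) \<in> r; c \<in> carrier A\<rbrakk> \<Longrightarrow> (a \<oplus> c, b \<oplus> c) \<in> r"
    and smult_mono: "\<lbrakk>(a, b) \<in> r; 0 \<le> q\<rbrakk> \<Longrightarrow> (q \<odot> a, q \<odot> b) \<in> r"
    and prod_less: "\<lbrakk>(\<zero>, a) \<in> r; a \<noteq> \<zero>; b \<in> carrier A\<rbrakk> \<Longrightarrow>
      (a \<otimes> b, a) \<in> r \<and> a \<otimes> b \<noteq> a \<and> (b \<otimes> a, a) \<in> r \<and> b \<otimes> a \<noteq> a"

locale lie_algebra = algebra_over_field L
  for L :: "('k::field, 'a, 'm) module_scheme" (structure) +
  assumes alternating: "x \<in> carrier L \<Longrightarrow> x \<otimes> x = \<zero>"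
    and jacobi: "\<lbrakk>x \<in> carrier L; y \<in> carrier L; z \<in> carrier L\<rbrakk> \<Longrightarrow>
      x \<otimes> (y \<otimes> z) \<oplus> y \<otimes> (z \<otimes> x) \<oplus> z \<otimes> (x \<otimes> y) = \<zero>"

primrec lie_lower_central :: "('k::field, 'a, 'm) module_scheme \<Rightarrow> nat \<Rightarrow> 'a set" where
  "lie_lower_central L 0 = carrier L"
| "lie_lower_central L (Suc n) = (\<lambda>H. submodule H (scalar_field :: 'k ring) L) hull
    {x \<otimes>\<^bsub>L\<^esub> y | x y. x \<in> carrier L \<and> y \<in> lie_lower_central L n}"

locale nilpotent_lie_algebra = lie_algebra L
  for L :: "('k::field, 'a, 'm) module_scheme" (structure) +
  assumes nilpotent: "\<exists>n. lie_lower_central L n = {\<zero>}"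

definition nilpotency_class :: "('k::field, 'a, 'm) module_scheme \<Rightarrow> nat" where
  "nilpotency_class L = (LEAST n. lie_lower_central L n = {\<zero>\<^bsub>L\<^esub>})"

section \<open>The Baker--Campbell--Hausdorff operation\<close>

text \<open>
  Formal power series over \<open>\<rat>\<close> in two noncommuting variables, as functions from words to
  coefficients. The sums for \<open>nc_exp\<close> and \<open>nc_ln1p\<close>, i.e. for \<open>exp f\<close> and \<open>log (1 + f)\<close>, assume that \<open>f\<close>
  has constant term 0, so that \<open>f\<^sup>n\<close> has coefficient 0 at all words shorter than \<open>n\<close>.
\<close>

datatype bch_var = X | Y
hide_const (open) X Y

type_synonym nc_series = "bch_var list \<Rightarrow> rat"

definition nc_var :: "bch_var \<Rightarrow> nc_series" where
  "nc_var v w = (if w = [v] then 1 else 0)"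

definition nc_one :: nc_series where
  "nc_one w = (if w = [] then 1 else 0)"

definition nc_mult :: "nc_series \<Rightarrow> nc_series \<Rightarrow> nc_series" where
  "nc_mult f g w = (\<Sum>i\<le>length w. f (take i w) * g (drop i w))"

primrec nc_power :: "nc_series \<Rightarrow> nat \<Rightarrow> nc_series" where
  "nc_power f 0 = nc_one"
| "nc_power f (Suc n) = nc_mult f (nc_power f n)"

definition nc_exp :: "nc_series \<Rightarrow> nc_series" where
  "nc_exp f w = (\<Sum>n\<le>length w. nc_power f n w / fact n)"

definition nc_ln1p :: "nc_series \<Rightarrow> nc_series" where
  "nc_ln1p f w = (\<Sum>n=1..length w. (- 1) ^ (n + 1) / of_nat n * nc_power f n w)"

text \<open>\<open>log (exp X exp Y)\<close>\<close>

definition bch_series :: nc_series where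
  "bch_series = nc_ln1p (\<lambda>w.
     nc_mult (nc_exp (nc_var bch_var.X)) (nc_exp (nc_var bch_var.Y)) w - nc_one w)"

text \<open>
  The right-nested product \<open>(v\<^sub>1,(v\<^sub>2,\<dots>(v\<^bsub>n-1\<^esub>,v\<^sub>n)\<dots>))\<close> of the values of the letters of a word.
\<close>

fun nested_product :: "('k, 'a, 'm) module_scheme \<Rightarrow> (bch_var \<Rightarrow> 'a) \<Rightarrow> bch_var list \<Rightarrow> 'a" where
  "nested_product L e [] = \<zero>\<^bsub>L\<^esub>"
| "nested_product L e [v] = e v"
| "nested_product L e (v # u # w) = e v \<otimes>\<^bsub>L\<^esub> nested_product L e (u # w)"

text \<open>
  \<open>log (exp X exp Y)\<close> is a Lie series, and by the Dynkin--Specht--Wever theorem its homogeneous part of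
  degree \<open>n\<close>, with coefficients \<open>c\<^sub>w\<close>, is the Lie polynomial \<open>1/n \<Sum>\<^bsub>|w|=n\<^esub> c\<^sub>w (w\<^sub>1,(w\<^sub>2,\<dots>,w\<^sub>n))\<close>. This is
  Dynkin's form of the Baker--Campbell--Hausdorff formula. In a nilpotent Lie algebra all brackets
  longer than the nilpotency class vanish.
\<close>

definition bch :: "(rat, 'a, 'm) module_scheme \<Rightarrow> 'a \<Rightarrow> 'a \<Rightarrow> 'a" where
  "bch L x y = (\<Oplus>\<^bsub>L\<^esub>w\<in>{w. w \<noteq> [] \<and> length w \<le> nilpotency_class L}.
     (bch_series w / of_nat (length w)) \<odot>\<^bsub>L\<^esub> nested_product L (case_bch_var x y) w)"

section \<open>The Malcev correspondence\<close>

text \<open>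
  \<open>L\<close> is the Lie algebra \<open>\<L>(G)\<close>. For a torsion free divisible nilpotent group \<open>G\<close> such an \<open>L\<close> exists and
  its operations on the carrier are unique.
\<close>

locale malcev_lie_algebra = nilpotent_lie_algebra L
  for G :: "('a, 'm) monoid_scheme" and L :: "(rat, 'a, 'n) module_scheme" (structure) +
  assumes carrier_eq: "carrier L = carrier G"
    and bch_eq: "\<lbrakk>x \<in> carrier G; y \<in> carrier G\<rbrakk> \<Longrightarrow> bch L x y = x \<otimes>\<^bsub>G\<^esub> y"
    and smult_eq: "a \<in> carrier G \<Longrightarrow> q \<odot> a = rat_pow G a q"

end

theory Submission
  imports Defs
begin

text \<open>
  For \<open>d > 1\<close> let \<open>C(d)\<close> be the set of elements that are infinitesimal with respect to \<open>d\<close>. By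
  nilpotency the commutators of \<open>d\<close> lie in \<open>C(d)\<close>, and \<open>C(d)\<close> is a normal subgroup closed under
  roots. Modulo an ideal that contains the Lie bracket of two elements, their
  Baker--Campbell--Hausdorff product is their sum. By nilpotency it follows that an ideal contains
  a group commutator iff it contains the corresponding bracket, and that normal subgroups closed
  under rational powers are ideals. So \<open>C(d)\<close> is an ideal containing all brackets of \<open>d\<close>, which are therefore less than \<open>d\<close>.
  If \<open>b = da\<close> with \<open>d > 1\<close>, then \<open>b + c\<close> and \<open>d (a + c)\<close> are congruent modulo \<open>C(d)\<close>, hence differ by
  a group factor that is infinitesimal with respect to \<open>d\<close>, and \<open>b + c > a + c\<close>.
\<close>

section \<open>Infinitesimal elements of nilpotent linearly ordered groups\<close>

context group
begin

lemma inv_mult_cancel: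
  assumes "x \<in> carrier G" "y \<in> carrier G"
  shows "inv x \<otimes> (x \<otimes> y) = y" "x \<otimes> (inv x \<otimes> y) = y"
  using assms by (simp_all flip: m_assoc)

lemmas group_simps = m_assoc inv_mult_group inv_mult_cancel

definition conjugate :: "'a \<Rightarrow> 'a \<Rightarrow> 'a" where
  "conjugate g x = g \<otimes> x \<otimes> inv g"

lemma conjugate_closed [simp]:
  "g \<in> carrier G \<Longrightarrow> x \<in> carrier G \<Longrightarrow> conjugate g x \<in> carrier G"
  by (simp add: conjugate_def)

lemma conjugate_mult:
  "g \<in> carrier G \<Longrightarrow> x \<in> carrier G \<Longrightarrow> y \<in> carrier G \<Longrightarrow>
    conjugate g (x \<otimes> y) = conjugate g x \<otimes> conjugate g y"
  by (simp add: conjugate_def group_simps)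

lemma conjugate_inv:
  "g \<in> carrier G \<Longrightarrow> x \<in> carrier G \<Longrightarrow> conjugate g (inv x) = inv (conjugate g x)"
  by (simp add: conjugate_def group_simps)

lemma conjugate_pow:
  "g \<in> carrier G \<Longrightarrow> x \<in> carrier G \<Longrightarrow> conjugate g (x [^] (n::nat)) = conjugate g x [^] n"
  by (induction n) (simp_all add: conjugate_mult, simp add: conjugate_def)

lemma conjugate_conjugate:
  "g \<in> carrier G \<Longrightarrow> h \<in> carrier G \<Longrightarrow> x \<in> carrier G \<Longrightarrow>
    conjugate g (conjugate h x) = conjugate (g \<otimes> h) x"
  by (simp add: conjugate_def group_simps)

lemma conjugate_one: "x \<in> carrier G \<Longrightarrow> conjugate \<one> x = x"
  by (simp add: conjugate_def)

end

section \<open>Arithmetic of two-sided linear orders on groups\<close>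

context linearly_ordered_group
begin

definition less (infix "\<prec>" 50) where "a \<prec> b \<longleftrightarrow> (a, b) \<in> r \<and> a \<noteq> b"

abbreviation less_eq (infix "\<preceq>" 50) where "a \<preceq> b \<equiv> (a, b) \<in> r"

lemma le_closed:
  assumes "a \<preceq> b"
  shows "a \<in> carrier G" "b \<in> carrier G"
  using assms linear_order by (auto simp: linear_order_on_def partial_order_on_def preorder_on_def)

lemma less_closed:
  assumes "a \<prec> b"
  shows "a \<in> carrier G" "b \<in> carrier G"
  using assms le_closed by (auto simp: less_def)

lemma le_refl: "a \<in> carrier G \<Longrightarrow> a \<preceq> a"
  using linear_order by (auto simp: linear_order_on_def partial_order_on_def preorder_on_def refl_on_def)

lemma le_trans [trans]: "a \<preceq> b \<Longrightarrow> b \<preceq> c \<Longrightarrow> a \<preceq> c"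
  using linear_order by (auto simp: linear_order_on_def partial_order_on_def preorder_on_def dest: transD)

lemma le_antisym: "a \<preceq> b \<Longrightarrow> b \<preceq> a \<Longrightarrow> a = b"
  using linear_order by (auto simp: linear_order_on_def partial_order_on_def dest: antisymD)

lemma le_total: "a \<in> carrier G \<Longrightarrow> b \<in> carrier G \<Longrightarrow> a \<preceq> b \<or> b \<preceq> a"
  using linear_order le_refl by (cases "a = b") (auto simp: linear_order_on_def total_on_def)

lemma less_le_trans [trans]: "a \<prec> b \<Longrightarrow> b \<preceq> c \<Longrightarrow> a \<prec> c"
  by (metis less_def le_trans le_antisym)

lemma le_less_trans [trans]: "a \<preceq> b \<Longrightarrow> b \<prec> c \<Longrightarrow> a \<prec> c"
  by (metis less_def le_trans le_antisym)

lemma less_trans [trans]: "a \<prec> b \<Longrightarrow> b \<prec> c \<Longrightarrow> a \<prec> c"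
  by (metis less_def le_less_trans)

lemma less_irrefl: "\<not> a \<prec> a"
  by (simp add: less_def)

lemma less_imp_le: "a \<prec> b \<Longrightarrow> a \<preceq> b"
  by (simp add: less_def)

lemma not_less: "a \<in> carrier G \<Longrightarrow> b \<in> carrier G \<Longrightarrow> \<not> a \<prec> b \<longleftrightarrow> b \<preceq> a"
  by (metis less_def le_total le_antisym le_refl)

lemma less_mult_right: "a \<prec> b \<Longrightarrow> c \<in> carrier G \<Longrightarrow> a \<otimes> c \<prec> b \<otimes> c"
  unfolding less_def using mult_right_mono le_closed right_cancel by metis

lemma less_mult_left: "a \<prec> b \<Longrightarrow> c \<in> carrier G \<Longrightarrow> c \<otimes> a \<prec> c \<otimes> b"
  unfolding less_def using mult_left_mono le_closed by (metis inv_mult_cancel(1))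

lemma mult_mono: "a \<preceq> b \<Longrightarrow> c \<preceq> d \<Longrightarrow> a \<otimes> c \<preceq> b \<otimes> d"
  by (meson le_closed le_trans mult_left_mono mult_right_mono)

lemma mult_le_less_mono: "a \<preceq> b \<Longrightarrow> c \<prec> d \<Longrightarrow> a \<otimes> c \<prec> b \<otimes> d"
  by (meson le_closed less_closed le_less_trans mult_right_mono less_mult_left)

lemma inv_antimono:
  assumes "a \<preceq> b"
  shows "inv b \<preceq> inv a"
proof -
  have "inv b \<otimes> a \<otimes> inv a \<preceq> inv b \<otimes> b \<otimes> inv a"
    using assms le_closed by (intro mult_right_mono mult_left_mono) auto
  then show ?thesis
    using le_closed[OF assms] by (simp add: m_assoc)
qed

lemma pow_mono: "a \<preceq> b \<Longrightarrow> a [^] (n::nat) \<preceq> b [^] n"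
  by (induction n) (auto intro: le_refl mult_mono)

lemma pow_strict_mono: "a \<prec> b \<Longrightarrow> 0 < n \<Longrightarrow> a [^] (n::nat) \<prec> b [^] n"
proof (induction n)
  case (Suc n)
  then show ?case
    using mult_le_less_mono[OF pow_mono[OF less_imp_le], of a b a b n] by simp
qed simp

lemma pow_le_imp_le:
  assumes "a [^] (n::nat) \<preceq> b [^] n" "0 < n" "a \<in> carrier G" "b \<in> carrier G"
  shows "a \<preceq> b"
  using assms pow_strict_mono[of b a n] not_less less_irrefl le_less_trans by metis

lemma one_le_pow: "\<one> \<preceq> a \<Longrightarrow> \<one> \<preceq> a [^] (n::nat)"
  using pow_mono[of \<one> a n] by simp

lemma pow_le_pow:
  assumes "\<one> \<preceq> a" "m \<le> (n::nat)"
  shows "a [^] m \<preceq> a [^] n"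
proof -
  have "a [^] m \<otimes> \<one> \<preceq> a [^] m \<otimes> a [^] (n - m)"
    using assms le_closed one_le_pow by (intro mult_left_mono) auto
  then show ?thesis
    using assms le_closed by (simp add: nat_pow_mult)
qed

lemma conjugate_less: "x \<prec> y \<Longrightarrow> g \<in> carrier G \<Longrightarrow> conjugate g x \<prec> conjugate g y"
  unfolding conjugate_def by (intro less_mult_left less_mult_right) auto

text \<open>With \<open>p = conjugate g v\<close> and \<open>s = v \<otimes> inv p\<close>, the
  hypothesis on the commutator reads \<open>s \<otimes> s \<prec> s \<otimes> p\<close>. Cancelling
  \<open>s\<close> on the left and multiplying by \<open>p\<close> on the right gives the
  claim.\<close>

lemma less_conjugate_square:
  assumes "v \<in> carrier G" "g \<in> carrier G" "inv (conjugate g v \<otimes> inv v) [^] (2::nat) \<prec> v"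
  shows "v \<prec> conjugate g v \<otimes> conjugate g v"
proof -
  define p where "p = conjugate g v"
  define s where "s = v \<otimes> inv p"
  have p: "p \<in> carrier G" and s: "s \<in> carrier G"
    using assms by (auto simp: p_def s_def)
  have sp: "s \<otimes> p = v"
    using assms p by (simp add: s_def group_simps)
  have "inv (conjugate g v \<otimes> inv v) = s"
    using assms p by (simp add: s_def group_simps flip: p_def)
  with assms have "s \<otimes> s \<prec> s \<otimes> p"
    using s by (simp add: sp numeral_2_eq_2)
  from less_mult_left[OF this, of "inv s"] have "s \<prec> p"
    using s p by (simp add: group_simps)
  from less_mult_right[OF this p] show ?thesis
    by (simp add: sp flip: p_def)
qed

text \<open>The square of the smaller factor is at most \<open>p \<otimes> q\<close>, whichever side
  that factor stands on.\<close>

lemma less_mult_if_less_squares: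
  assumes "v \<prec> p \<otimes> p" "v \<prec> q \<otimes> q" "p \<in> carrier G" "q \<in> carrier G"
  shows "v \<prec> p \<otimes> q"
proof (cases "p \<preceq> q")
  case True
  show ?thesis
    using assms(1) mult_left_mono[OF True assms(3)] by (rule less_le_trans)
next
  case False
  then have "q \<preceq> p"
    using le_total assms by blast
  from assms(2) mult_right_mono[OF this assms(4)] show ?thesis
    by (rule less_le_trans)
qed

text \<open>
  Iterating \<open>a = v \<otimes> conjugate g a\<close> writes \<open>a\<close> as the product of the conjugates of \<open>v\<close> by
  \<open>\<one>, g, g\<^sup>2, \<dots>, g\<^bsup>2n-1\<^esup>\<close> and an element greater than \<open>\<one>\<close>. Any two consecutive conjugates have a
  product greater than \<open>v\<close>.
\<close>

lemma pow_less_if_mult_conjugate: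
  assumes "\<one> \<prec> a" "v \<in> carrier G" "g \<in> carrier G" "v \<otimes> conjugate g a = a"
    and v: "\<And>h. h \<in> carrier G \<Longrightarrow> v \<prec> conjugate h v \<otimes> conjugate h v"
  shows "v [^] (n::nat) \<prec> a"
proof -
  have a: "a \<in> carrier G"
    using assms(1) less_closed by blast
  have conj_v: "conjugate (g [^] t) v \<otimes> conjugate (g [^] Suc t) a = conjugate (g [^] t) a"
    for t :: nat
  proof -
    have "conjugate (g [^] t) v \<otimes> conjugate (g [^] Suc t) a = conjugate (g [^] t) (v \<otimes> conjugate g a)"
      using assms(2,3) a by (simp add: conjugate_conjugate conjugate_mult)
    then show ?thesis
      by (simp add: assms(4))
  qed
  have "\<exists>P\<in>carrier G. v [^] n \<preceq> P \<and> P \<otimes> conjugate (g [^] (2 * n)) a = a"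
  proof (induction n)
    case 0
    then show ?case
      using a by (auto intro!: bexI[of _ \<one>] simp: conjugate_one le_refl)
  next
    case (Suc n)
    then obtain P where P: "P \<in> carrier G" "v [^] n \<preceq> P" "P \<otimes> conjugate (g [^] (2 * n)) a = a"
      by blast
    define p where "p = conjugate (g [^] (2 * n)) v"
    define q where "q = conjugate (g [^] Suc (2 * n)) v"
    have pq: "p \<in> carrier G" "q \<in> carrier G"
      using assms unfolding p_def q_def by simp_all
    have "v \<prec> p \<otimes> q"
      using pq by (rule less_mult_if_less_squares[rotated 2]) (simp_all only: p_def q_def v assms(3) nat_pow_closed)
    then have "v [^] Suc n \<preceq> P \<otimes> (p \<otimes> q)"
      using P mult_mono[OF _ less_imp_le] by simp
    moreover have "P \<otimes> (p \<otimes> q) \<otimes> conjugate (g [^] (2 * Suc n)) a = a"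
    proof -
      have "P \<otimes> (p \<otimes> q) \<otimes> conjugate (g [^] (2 * Suc n)) a =
          P \<otimes> (p \<otimes> (q \<otimes> conjugate (g [^] Suc (Suc (2 * n))) a))"
        using P pq assms a by (simp add: m_assoc)
      also have "\<dots> = a"
        unfolding p_def q_def conj_v using P by simp
      finally show ?thesis .
    qed
    ultimately show ?case
      using P pq by blast
  qed
  then obtain P where P: "P \<in> carrier G" "v [^] n \<preceq> P" "P \<otimes> conjugate (g [^] (2 * n)) a = a"
    by blast
  have "\<one> \<prec> conjugate (g [^] (2 * n)) a"
    using conjugate_less[OF assms(1), of "g [^] (2 * n)"] assms by (simp add: conjugate_def)
  from less_mult_left[OF this P(1)] have "P \<prec> a"
    using P by simp
  with P(2) show ?thesis
    by (rule le_less_trans)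
qed

section \<open>Infinitesimal elements with respect to a fixed element\<close>

definition infinitesimal :: "'a \<Rightarrow> 'a set" where
  "infinitesimal d = {x \<in> carrier G. \<forall>n::nat. x [^] n \<prec> d \<and> inv x [^] n \<prec> d}"

lemma infinitesimal_closed: "x \<in> infinitesimal d \<Longrightarrow> x \<in> carrier G"
  by (simp add: infinitesimal_def)

lemma infinitesimal_less: "x \<in> infinitesimal d \<Longrightarrow> x \<prec> d"
  by (auto simp: infinitesimal_def dest: spec[of _ 1])

lemma infinitesimal_inv: "x \<in> infinitesimal d \<Longrightarrow> inv x \<in> infinitesimal d"
  by (simp add: infinitesimal_def)

text \<open>Powers of \<open>m [^] k\<close> are again powers of \<open>m\<close>, hence below
  \<open>d\<close>. Closure properties are reduced to finding such a bound for an element and its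
  inverse.\<close>

lemma infinitesimal_leI:
  assumes "m \<in> infinitesimal d" "x \<preceq> m [^] (k::nat)" "inv x \<preceq> m [^] k"
  shows "x \<in> infinitesimal d"
proof -
  have x: "x \<in> carrier G" and m: "m \<in> carrier G"
    using assms le_closed infinitesimal_closed by auto
  have "y [^] n \<prec> d" if "y \<preceq> m [^] k" for y and n :: nat
    using le_less_trans[OF pow_mono[OF that, of n]] assms(1) m
    by (simp add: infinitesimal_def nat_pow_pow)
  with assms x show ?thesis
    by (auto simp: infinitesimal_def)
qed

text \<open>The bound is the absolute value of \<open>x\<close>: the one of \<open>x\<close> and
  \<open>inv x\<close> that is at least \<open>\<one>\<close>.\<close>

lemma infinitesimal_bound:
  assumes "x \<in> infinitesimal d"
  obtains m where "m \<in> infinitesimal d" "\<one> \<preceq> m" "x \<preceq> m" "inv x \<preceq> m"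
proof (cases "\<one> \<preceq> x")
  case True
  with inv_antimono[OF True] have "inv x \<preceq> x"
    using le_trans by fastforce
  with that[of x] assms True le_refl show ?thesis
    by (auto simp: infinitesimal_closed)
next
  case False
  then have "x \<preceq> \<one>"
    using le_total assms infinitesimal_closed by blast
  from inv_antimono[OF this] have *: "\<one> \<preceq> inv x"
    by simp
  with \<open>x \<preceq> \<one>\<close> have "x \<preceq> inv x"
    using le_trans by blast
  with that[of "inv x"] assms * show ?thesis
    by (simp add: le_refl infinitesimal_closed infinitesimal_inv)
qed

lemma infinitesimal_bound2:
  assumes "x \<in> infinitesimal d" "y \<in> infinitesimal d"
  obtains m where "m \<in> infinitesimal d" "x \<preceq> m" "inv x \<preceq> m" "y \<preceq> m" "inv y \<preceq> m"
proof -
  obtain m where m: "m \<in> infinitesimal d" "\<one> \<preceq> m" "x \<preceq> m" "inv x \<preceq> m"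
    using infinitesimal_bound assms by blast
  obtain l where l: "l \<in> infinitesimal d" "\<one> \<preceq> l" "y \<preceq> l" "inv y \<preceq> l"
    using infinitesimal_bound assms by blast
  consider "m \<preceq> l" | "l \<preceq> m"
    using le_total infinitesimal_closed m l by blast
  then show ?thesis
  proof cases
    case 1
    show ?thesis
      by (rule that[of l]) (use m l 1 le_trans in blast)+
  next
    case 2
    show ?thesis
      by (rule that[of m]) (use m l 2 le_trans in blast)+
  qed
qed

text \<open>Powers of \<open>x \<otimes> y\<close> do not split in a noncommutative group. A common
  bound \<open>m\<close> avoids this, since both \<open>x \<otimes> y\<close> and its inverse are at
  most \<open>m [^] 2\<close>.\<close>

lemma infinitesimal_mult:
  assumes "x \<in> infinitesimal d" "y \<in> infinitesimal d"
  shows "x \<otimes> y \<in> infinitesimal d"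
proof -
  obtain m where m: "m \<in> infinitesimal d" "x \<preceq> m" "inv x \<preceq> m" "y \<preceq> m" "inv y \<preceq> m"
    using infinitesimal_bound2 assms by blast
  have "x \<otimes> y \<preceq> m [^] (2::nat)" "inv (x \<otimes> y) \<preceq> m [^] (2::nat)"
    using assms m mult_mono[of x m y m] mult_mono[of "inv y" m "inv x" m]
    by (simp_all add: numeral_2_eq_2 inv_mult_group infinitesimal_closed)
  with m(1) show ?thesis
    by (rule infinitesimal_leI)
qed

text \<open>The power \<open>n = 0\<close> in the definition of \<open>infinitesimal\<close> already
  says \<open>\<one> \<prec> d\<close>, so the set is empty for any other \<open>d\<close>.\<close>

lemma infinitesimal_subgroup:
  assumes "\<one> \<prec> d"
  shows "subgroup (infinitesimal d) G"
proof (rule subgroupI)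
  show "infinitesimal d \<noteq> {}"
    using assms by (auto simp: infinitesimal_def intro!: exI[of _ \<one>])
qed (auto simp: infinitesimal_closed infinitesimal_inv infinitesimal_mult)

lemma infinitesimal_root:
  assumes "y [^] (n::nat) \<in> infinitesimal d" "y \<in> carrier G" "0 < n"
  shows "y \<in> infinitesimal d"
proof -
  obtain m where m: "m \<in> infinitesimal d" "\<one> \<preceq> m" "y [^] n \<preceq> m" "inv (y [^] n) \<preceq> m"
    using infinitesimal_bound assms by blast
  \<comment> \<open>The bound for the power bounds the root itself: if \<open>z\<close> is at least
    \<open>\<one>\<close> then \<open>z\<close> is at most \<open>z [^] n\<close>, and otherwise
    \<open>z\<close> is below \<open>\<one>\<close>, which is at most \<open>m\<close>.\<close>
  have "z \<preceq> m" if "z [^] n \<preceq> m" "z \<in> carrier G" for z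
  proof (cases "\<one> \<preceq> z")
    case True
    from pow_le_pow[OF this, of 1 n] that assms le_trans show ?thesis
      by auto
  next
    case False
    with that m le_total le_trans show ?thesis
      by blast
  qed
  from this[of y] this[of "inv y"] have "y \<preceq> m [^] (1::nat)" "inv y \<preceq> m [^] (1::nat)"
    using m assms by (simp_all add: nat_pow_inv infinitesimal_closed)
  with m(1) show ?thesis
    by (rule infinitesimal_leI)
qed

end

section \<open>Commutators in nilpotent linearly ordered groups\<close>

locale linearly_ordered_nilpotent_group = linearly_ordered_group + nilpotent_group
begin

text \<open>The core of the inductive step for \<open>commutator_infinitesimal\<close>. By its
  definition \<open>v\<close> satisfies \<open>v \<otimes> conjugate h a = a\<close>. Since the
  commutators of \<open>v\<close> are infinitesimal with respect to \<open>v\<close>, the square of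
  every conjugate of \<open>v\<close> exceeds \<open>v\<close>, so
  \<open>pow_less_if_mult_conjugate\<close> applies.\<close>

lemma pow_commutator_less:
  assumes a: "\<one> \<prec> a" and h: "h \<in> carrier G"
    and v_def: "v = inv (conjugate h a \<otimes> inv a)" and "\<one> \<preceq> v"
    and v: "\<And>g. \<one> \<prec> v \<Longrightarrow> g \<in> carrier G \<Longrightarrow> conjugate g v \<otimes> inv v \<in> infinitesimal v"
  shows "v [^] (n::nat) \<prec> a"
proof (cases "v = \<one>")
  case True
  with a show ?thesis
    by simp
next
  case False
  with \<open>\<one> \<preceq> v\<close> have "\<one> \<prec> v"
    by (simp add: less_def)
  have ac: "a \<in> carrier G" and vc: "v \<in> carrier G"
    using less_closed a \<open>\<one> \<prec> v\<close> by auto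
  show ?thesis
  proof (rule pow_less_if_mult_conjugate[OF a vc h])
    show "v \<otimes> conjugate h a = a"
      using h ac by (simp add: v_def group_simps)
    show "v \<prec> conjugate g v \<otimes> conjugate g v" if "g \<in> carrier G" for g
      using v[OF \<open>\<one> \<prec> v\<close> that] that vc
      by (intro less_conjugate_square) (auto simp: infinitesimal_def)
  qed
qed

text \<open>Downward induction along the lower central series. The last term is trivial and has no
  element above \<open>\<one>\<close>. Commutators of elements of one term lie in the next, where
  the induction hypothesis controls their own commutators.\<close>

theorem commutator_infinitesimal:
  assumes "\<one> \<prec> a" "g \<in> carrier G"
  shows "conjugate g a \<otimes> inv a \<in> infinitesimal a"
proof -
  obtain N where N: "group_lower_central G N = {\<one>}"
    using nilpotent by blast
  have "\<forall>a\<in>group_lower_central G k. \<forall>g\<in>carrier G. \<one> \<prec> a \<longrightarrow> conjugate g a \<otimes> inv a \<in> infinitesimal a"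
    if "k \<le> N" for k
    using that
  proof (induction rule: inc_induct)
    case base
    then show ?case
      by (simp add: N less_irrefl)
  next
    case (step k)
    show ?case
    proof (intro ballI impI)
      fix a g
      assume a: "a \<in> group_lower_central G k" "\<one> \<prec> a" and g: "g \<in> carrier G"
      have ac: "a \<in> carrier G"
        using a less_closed by blast
      have pow_less: "inv (conjugate h a \<otimes> inv a) [^] (n::nat) \<prec> a"
        if h: "h \<in> carrier G" and le: "\<one> \<preceq> inv (conjugate h a \<otimes> inv a)" for h n
      proof (rule pow_commutator_less[OF a(2) h refl le])
        fix g
        assume "\<one> \<prec> inv (conjugate h a \<otimes> inv a)" "g \<in> carrier G"
        moreover have "inv (conjugate h a \<otimes> inv a) \<in> group_lower_central G (Suc k)"
          unfolding group_lower_central.simps conjugate_def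
          using h a(1) by (intro generate.inv) blast
        ultimately show "conjugate g (inv (conjugate h a \<otimes> inv a)) \<otimes>
            inv (inv (conjugate h a \<otimes> inv a)) \<in> infinitesimal (inv (conjugate h a \<otimes> inv a))"
          using step.IH by blast
      qed
      define u where "u = conjugate g a \<otimes> inv a"
      have u: "u \<in> carrier G"
        using g ac by (simp add: u_def)
      have "u [^] n \<prec> a \<and> inv u [^] n \<prec> a" for n :: nat
      proof (cases "\<one> \<preceq> u")
        case True
        \<comment> \<open>\<open>pow_less\<close> bounds only inverses of commutators. The
          commutator \<open>u\<close> is the conjugate by \<open>g\<close> of such an inverse, taken
          for \<open>inv g\<close>.\<close>
        define v where "v = inv (conjugate (inv g) a \<otimes> inv a)"
        have v: "v \<in> carrier G" and conj_v: "conjugate g v = u"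
          using g ac by (simp_all add: v_def u_def conjugate_def group_simps)
        have "v = conjugate (inv g) u"
          using g u v by (simp add: conjugate_conjugate conjugate_one flip: conj_v)
        with mult_left_mono[OF mult_right_mono[OF True, of g], of "inv g"] have "\<one> \<preceq> v"
          using g u by (simp add: conjugate_def m_assoc)
        \<comment> \<open>The extra power pays for the conjugation: conjugating turns
          \<open>a\<close> into \<open>u \<otimes> a\<close>, and one factor \<open>u\<close> is
          cancelled.\<close>
        then have "v [^] Suc n \<prec> a"
          unfolding v_def using g by (intro pow_less) auto
        from conjugate_less[OF this g] have "u [^] Suc n \<prec> conjugate g a"
          using g v by (simp only: conjugate_pow conj_v)
        moreover have "conjugate g a = u \<otimes> a"
          using g ac by (simp add: u_def group_simps)
        ultimately have "u \<otimes> u [^] n \<prec> u \<otimes> a"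
          using u by (simp only: nat_pow_Suc2)
        from less_mult_left[OF this, of "inv u"] have "u [^] n \<prec> a"
          using u ac by (simp add: inv_mult_cancel)
        moreover have "inv u [^] n \<preceq> \<one>"
          using pow_mono[OF inv_antimono[OF True], of n] by simp
        ultimately show ?thesis
          using a(2) le_less_trans by blast
      next
        case False
        then have "u \<preceq> \<one>"
          using le_total u by blast
        with pow_mono[of u \<one> n] have "u [^] n \<prec> a"
          using a(2) le_less_trans by simp
        moreover have "inv u [^] n \<prec> a"
          using inv_antimono[OF \<open>u \<preceq> \<one>\<close>] g unfolding u_def by (intro pow_less) auto
        ultimately show ?thesis ..
      qed
      then show "conjugate g a \<otimes> inv a \<in> infinitesimal a"
        using u by (simp add: infinitesimal_def flip: u_def)
    qed
  qed
  from this[of 0] assms less_closed show ?thesis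
    by auto
qed

text \<open>Conjugating back, it suffices to compare \<open>y [^] n\<close> with the conjugate
  \<open>e\<close> of \<open>d\<close>. Commutators of \<open>d\<close> are infinitesimal, so
  \<open>d \<prec> e \<otimes> e\<close>. As \<open>y [^] (2 * n) \<prec> d\<close>, the element
  \<open>y [^] n\<close> cannot reach \<open>e\<close>.\<close>

lemma infinitesimal_normal:
  assumes "\<one> \<prec> d"
  shows "infinitesimal d \<lhd> G"
proof (rule normal_invI[OF infinitesimal_subgroup[OF assms]])
  fix g x
  assume g: "g \<in> carrier G" and x: "x \<in> infinitesimal d"
  have d: "d \<in> carrier G"
    using assms less_closed by blast
  have less: "conjugate g y [^] n \<prec> d" if y: "y \<in> infinitesimal d" for y and n :: nat
  proof -
    have yc: "y \<in> carrier G"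
      using y infinitesimal_closed by blast
    define e where "e = conjugate (inv g) d"
    have e: "e \<in> carrier G"
      using g d by (simp add: e_def)
    have "d \<prec> e \<otimes> e"
      unfolding e_def using commutator_infinitesimal[OF assms, of "inv g"] g d
      by (intro less_conjugate_square) (auto simp: infinitesimal_def)
    moreover have "y [^] (2 * n) \<prec> d"
      using y by (simp add: infinitesimal_def)
    moreover have "y [^] (2 * n) = y [^] n \<otimes> y [^] n"
      using yc by (simp add: nat_pow_mult mult_2)
    ultimately have "y [^] n \<otimes> y [^] n \<prec> e \<otimes> e"
      using less_trans by simp
    then have "\<not> e \<preceq> y [^] n"
      using mult_mono[of e "y [^] n" e "y [^] n"] less_le_trans less_irrefl by blast
    then have "y [^] n \<prec> e"
      using not_less e yc by blast
    from conjugate_less[OF this g] show ?thesis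
      using g d yc by (simp add: conjugate_pow e_def conjugate_conjugate conjugate_one)
  qed
  have "conjugate g x \<in> infinitesimal d"
    using less[OF x] less[OF infinitesimal_inv[OF x]] g infinitesimal_closed[OF x]
    by (simp add: infinitesimal_def conjugate_inv)
  then show "g \<otimes> x \<otimes> inv g \<in> infinitesimal d"
    by (simp add: conjugate_def)
qed

end

section \<open>Ideals of nilpotent Lie algebras\<close>

lemma scalar_field_simps [simp]:
  "carrier scalar_field = UNIV" "mult scalar_field = (*)" "one scalar_field = 1"
  "zero scalar_field = 0" "add scalar_field = (+)"
  by (simp_all add: scalar_field_def)

section \<open>Bracket arithmetic and ideals\<close>

context lie_algebra
begin

lemma smult_0 [simp]: "x \<in> carrier L \<Longrightarrow> 0 \<odot> x = \<zero>"
  using smult_l_null[of x] by simp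

lemma smult_1 [simp]: "x \<in> carrier L \<Longrightarrow> 1 \<odot> x = x"
  using smult_one[of x] by simp

lemma prod_zero_right [simp]: "x \<in> carrier L \<Longrightarrow> x \<otimes> \<zero> = \<zero>"
  using prod_smult_right[of x \<zero> 0] prod_closed by simp

lemma smult_minus_one: "x \<in> carrier L \<Longrightarrow> (- 1) \<odot> x = \<ominus> x"
proof -
  assume x: "x \<in> carrier L"
  have "(- 1) \<odot> x \<oplus> x = (- 1 + 1) \<odot> x"
    using smult_l_distr[of "- 1" 1 x] x by simp
  then show ?thesis
    using x smult_closed[of "- 1" x] by (intro M.minus_equality[symmetric]) auto
qed

lemma prod_minus_right: "x \<in> carrier L \<Longrightarrow> y \<in> carrier L \<Longrightarrow> x \<otimes> (\<ominus> y) = \<ominus> (x \<otimes> y)"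
  by (simp add: prod_smult_right prod_closed flip: smult_minus_one)

lemma anticommute:
  assumes "x \<in> carrier L" "y \<in> carrier L"
  shows "x \<otimes> y = \<ominus> (y \<otimes> x)"
proof -
  have "(x \<oplus> y) \<otimes> (x \<oplus> y) = x \<otimes> y \<oplus> y \<otimes> x"
    using assms by (simp add: prod_add_left prod_add_right prod_closed alternating[of x] alternating[of y] M.a_comm)
  then have "x \<otimes> y \<oplus> y \<otimes> x = \<zero>"
    using alternating[of "x \<oplus> y"] assms by simp
  then show ?thesis
    using assms by (intro M.minus_equality[symmetric]) (auto simp: prod_closed)
qed

definition lie_ideal :: "'a set \<Rightarrow> bool" where
  "lie_ideal I \<longleftrightarrow> submodule I (scalar_field :: 'k ring) L \<and> (\<forall>x\<in>carrier L. \<forall>y\<in>I. x \<otimes> y \<in> I)"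

lemma lie_idealI:
  assumes "I \<subseteq> carrier L" "\<zero> \<in> I" "\<And>x y. x \<in> I \<Longrightarrow> y \<in> I \<Longrightarrow> x \<oplus> y \<in> I"
    "\<And>q x. x \<in> I \<Longrightarrow> q \<odot> x \<in> I" "\<And>x y. x \<in> carrier L \<Longrightarrow> y \<in> I \<Longrightarrow> x \<otimes> y \<in> I"
  shows "lie_ideal I"
  unfolding lie_ideal_def
proof (intro conjI submoduleI ballI)
  show "\<ominus> x \<in> I" if "x \<in> I" for x
    using assms(4)[OF that, of "- 1"] that assms(1) by (auto simp: smult_minus_one)
qed (use assms in auto)

context
  fixes I
  assumes I: "lie_ideal I"
begin

lemma lie_ideal_closed: "x \<in> I \<Longrightarrow> x \<in> carrier L"
  using I submoduleE(1)[of I] by (auto simp: lie_ideal_def)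

lemma lie_ideal_add: "x \<in> I \<Longrightarrow> y \<in> I \<Longrightarrow> x \<oplus> y \<in> I"
  using I submoduleE(5)[of I] by (auto simp: lie_ideal_def)

lemma lie_ideal_smult: "x \<in> I \<Longrightarrow> q \<odot> x \<in> I"
  using I submoduleE(4)[of I] by (auto simp: lie_ideal_def)

lemma lie_ideal_prod_right: "x \<in> carrier L \<Longrightarrow> y \<in> I \<Longrightarrow> x \<otimes> y \<in> I"
  using I by (auto simp: lie_ideal_def)

lemma lie_ideal_minus: "x \<in> I \<Longrightarrow> \<ominus> x \<in> I"
  using lie_ideal_smult[of x "- 1"] by (simp add: smult_minus_one lie_ideal_closed)

lemma lie_ideal_prod_left: "x \<in> I \<Longrightarrow> y \<in> carrier L \<Longrightarrow> x \<otimes> y \<in> I"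
  using anticommute[of x y] lie_ideal_minus lie_ideal_prod_right lie_ideal_closed by simp

lemma lie_ideal_prod_commute: "x \<in> carrier L \<Longrightarrow> y \<in> carrier L \<Longrightarrow> x \<otimes> y \<in> I \<Longrightarrow> y \<otimes> x \<in> I"
  using anticommute[of y x] lie_ideal_minus by simp

lemma lie_ideal_zero: "\<zero> \<in> I"
  using I submoduleE(2)[of I] lie_ideal_smult[of _ 0] lie_ideal_closed
  by (fastforce simp: lie_ideal_def)

lemma lie_ideal_finsum:
  assumes "finite A" "\<And>w. w \<in> A \<Longrightarrow> f w \<in> I"
  shows "finsum L f A \<in> I"
  using assms
proof (induction rule: finite_induct)
  case (insert w A)
  then have "finsum L f (insert w A) = f w \<oplus> finsum L f A"
    using lie_ideal_closed by (intro M.finsum_insert) auto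
  with insert show ?case
    by (simp add: lie_ideal_add)
qed (simp add: lie_ideal_zero)

end

section \<open>Congruence modulo an ideal\<close>

definition cong :: "'a set \<Rightarrow> 'a \<Rightarrow> 'a \<Rightarrow> bool" where
  "cong I x y \<longleftrightarrow> x \<in> carrier L \<and> y \<in> carrier L \<and> x \<ominus> y \<in> I"

lemma cong_iff_add: "cong I x y \<longleftrightarrow> y \<in> carrier L \<and> (\<exists>s\<in>I \<inter> carrier L. x = y \<oplus> s)"
proof
  assume "cong I x y"
  then have "x \<ominus> y \<in> I \<inter> carrier L" "x = y \<oplus> (x \<ominus> y)" "y \<in> carrier L"
    unfolding cong_def by (auto simp: a_minus_def M.a_ac M.r_neg M.r_neg2)
  then show "y \<in> carrier L \<and> (\<exists>s\<in>I \<inter> carrier L. x = y \<oplus> s)"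
    by blast
next
  assume "y \<in> carrier L \<and> (\<exists>s\<in>I \<inter> carrier L. x = y \<oplus> s)"
  then obtain s where "y \<in> carrier L" "s \<in> I" "s \<in> carrier L" "x = y \<oplus> s"
    by blast
  moreover from this have "(y \<oplus> s) \<ominus> y = s"
    by (simp add: a_minus_def M.a_ac M.r_neg1 M.r_neg)
  ultimately show "cong I x y"
    by (simp add: cong_def)
qed

context
  fixes I
  assumes I: "lie_ideal I"
begin

lemma cong_refl: "x \<in> carrier L \<Longrightarrow> cong I x x"
  unfolding cong_iff_add by (auto intro!: bexI[of _ \<zero>] simp: lie_ideal_zero[OF I])

lemma cong_sym:
  assumes "cong I x y"
  shows "cong I y x"
proof -
  have "y \<ominus> x = \<ominus> (x \<ominus> y)"
    using assms by (simp add: cong_def a_minus_def M.minus_add M.a_comm)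
  with assms lie_ideal_minus[OF I] show ?thesis
    by (auto simp: cong_def)
qed

lemma cong_add:
  assumes "cong I x y" "cong I x' y'"
  shows "cong I (x \<oplus> x') (y \<oplus> y')"
proof -
  obtain s s' where s: "s \<in> I" "s' \<in> I" "s \<in> carrier L" "s' \<in> carrier L" "x = y \<oplus> s" "x' = y' \<oplus> s'"
    "y \<in> carrier L" "y' \<in> carrier L"
    using assms by (auto simp: cong_iff_add)
  have "x \<oplus> x' = y \<oplus> y' \<oplus> (s \<oplus> s')"
    using s by (simp add: M.a_ac)
  with s show ?thesis
    using lie_ideal_add[OF I] by (auto simp: cong_iff_add)
qed

lemma cong_trans:
  assumes "cong I x y" "cong I y z"
  shows "cong I x z"
proof -
  obtain s s' where s: "s \<in> I" "s' \<in> I" "s \<in> carrier L" "s' \<in> carrier L" "x = y \<oplus> s" "y = z \<oplus> s'"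
    "z \<in> carrier L"
    using assms by (auto simp: cong_iff_add)
  then have "x = z \<oplus> (s' \<oplus> s)" "s' \<oplus> s \<in> I \<inter> carrier L"
    using lie_ideal_add[OF I] by (simp_all add: M.a_assoc)
  with s(7) show ?thesis
    unfolding cong_iff_add by blast
qed

lemma cong_zero_iff: "cong I x \<zero> \<longleftrightarrow> x \<in> I"
  using lie_ideal_closed[OF I] by (auto simp: cong_iff_add)

end

section \<open>The lower central series of a Lie algebra\<close>

lemma submodule_hull:
  fixes X :: "'a set"
  assumes "X \<subseteq> carrier L"
  shows "submodule ((\<lambda>H. submodule H (scalar_field :: 'k ring) L) hull X) (scalar_field :: 'k ring) L"
proof (rule submoduleI)
  show "(\<lambda>H. submodule H (scalar_field :: 'k ring) L) hull X \<subseteq> carrier L"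
    using assms carrier_is_submodule by (rule hull_minimal)
  show "\<zero> \<in> (\<lambda>H. submodule H (scalar_field :: 'k ring) L) hull X"
    using submodule.axioms(1)[THEN subgroup.one_closed] by (auto simp: hull_def)
qed (use submoduleE in \<open>auto simp: hull_def\<close>)

text \<open>The two claims need each other. A term absorbs brackets because it lies in its
  predecessor, whose brackets generate it; the next inclusion follows from this absorption.\<close>

lemma lie_lower_central_ideal: "lie_ideal (lie_lower_central L k)"
  and lie_lower_central_Suc: "lie_lower_central L (Suc k) \<subseteq> lie_lower_central L k"
proof (induction k)
  case 0
  show 1: "lie_ideal (lie_lower_central L 0)"
    using carrier_is_submodule by (simp add: lie_ideal_def prod_closed)
  show "lie_lower_central L (Suc 0) \<subseteq> lie_lower_central L 0"
    unfolding lie_lower_central.simps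
    using carrier_is_submodule by (intro hull_minimal) (auto simp: prod_closed)
next
  case (Suc k)
  show ideal: "lie_ideal (lie_lower_central L (Suc k))"
    unfolding lie_ideal_def
  proof (intro conjI ballI)
    show "submodule (lie_lower_central L (Suc k)) (scalar_field :: 'k ring) L"
      unfolding lie_lower_central.simps using lie_ideal_closed[OF Suc(1)] prod_closed
      by (intro submodule_hull) auto
    fix x y
    assume "x \<in> carrier L" "y \<in> lie_lower_central L (Suc k)"
    with Suc(2) show "x \<otimes> y \<in> lie_lower_central L (Suc k)"
      by (subst lie_lower_central.simps) (intro hull_inc, blast)
  qed
  show "lie_lower_central L (Suc (Suc k)) \<subseteq> lie_lower_central L (Suc k)"
    unfolding lie_lower_central.simps(2)[of L "Suc k"]
    using ideal by (intro hull_minimal) (auto simp: lie_ideal_def)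
qed

lemma prod_lie_lower_central:
  "x \<in> carrier L \<Longrightarrow> y \<in> lie_lower_central L k \<Longrightarrow> x \<otimes> y \<in> lie_lower_central L (Suc k)"
  unfolding lie_lower_central.simps by (rule hull_inc) blast

lemma lie_lower_central_antimono:
  "m \<le> n \<Longrightarrow> lie_lower_central L n \<subseteq> lie_lower_central L m"
  using lie_lower_central_Suc by (rule lift_Suc_antimono_le)

text \<open>The preimage in \<open>L\<close> of the center of the quotient of \<open>L\<close> by
  \<open>J\<close>.\<close>

definition colon :: "'a set \<Rightarrow> 'a set" where
  "colon J = {y \<in> carrier L. \<forall>x\<in>carrier L. x \<otimes> y \<in> J}"

lemma colon_ideal:
  assumes "lie_ideal J"
  shows "lie_ideal (colon J)"
proof (rule lie_idealI)
  fix x y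
  assume "x \<in> carrier L" "y \<in> colon J"
  then show "x \<otimes> y \<in> colon J"
    using lie_ideal_prod_right[OF assms] by (auto simp: colon_def prod_closed)
qed (use lie_ideal_zero[OF assms] lie_ideal_add[OF assms] lie_ideal_smult[OF assms] in
    \<open>auto simp: colon_def prod_add_right prod_smult_right\<close>)

section \<open>Nested brackets and ideals\<close>

lemma nested_product_closed:
  assumes "\<And>v. e v \<in> carrier L"
  shows "nested_product L e w \<in> carrier L"
  using assms by (induction w rule: induct_list012) (auto simp: prod_closed)

text \<open>The shift by one is due to the series starting at index 0 with the whole algebra: a
  single letter has no bracket yet.\<close>

lemma nested_product_lower_central:
  assumes "\<And>v. e v \<in> carrier L"
  shows "w \<noteq> [] \<Longrightarrow> nested_product L e w \<in> lie_lower_central L (length w - 1)"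
proof (induction w rule: induct_list012)
  case (3 u v w)
  then have "nested_product L e (v # w) \<in> lie_lower_central L (length w)"
    by simp
  from prod_lie_lower_central[OF assms this] show ?case
    by simp
qed (use assms in auto)

text \<open>The innermost bracket of two letters is zero or, up to sign,
  \<open>x \<otimes> y\<close>; the outer brackets are absorbed by the ideal.\<close>

lemma nested_product_in_ideal:
  assumes I: "lie_ideal I" and x: "x \<in> carrier L" and y: "y \<in> carrier L" and xy: "x \<otimes> y \<in> I"
  shows "2 \<le> length w \<Longrightarrow> nested_product L (case_bch_var x y) w \<in> I"
proof (induction w rule: induct_list012)
  case (3 u v w)
  show ?case
  proof (cases w)
    case Nil
    then show ?thesis
      using x y xy lie_ideal_prod_commute[OF I x y xy] lie_ideal_zero[OF I]
      by (auto split: bch_var.splits simp: alternating)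
  next
    case (Cons v' w')
    with 3 show ?thesis
      using x y by (auto intro!: lie_ideal_prod_right[OF I] split: bch_var.splits)
  qed
qed auto

text \<open>Without its first letter the word still has two letters, so its bracket is in
  \<open>colon J\<close>; the outermost bracket then lands in \<open>J\<close>.\<close>

lemma nested_product_in_ideal_colon:
  assumes J: "lie_ideal J" and x: "x \<in> carrier L" and y: "y \<in> carrier L" and xy: "x \<otimes> y \<in> colon J"
    and w: "3 \<le> length w"
  shows "nested_product L (case_bch_var x y) w \<in> J"
proof -
  obtain u v w' where w': "w = u # v # w'"
    using w by (metis Suc_le_length_iff numeral_3_eq_3)
  with w have "nested_product L (case_bch_var x y) (v # w') \<in> colon J"
    by (intro nested_product_in_ideal[OF colon_ideal[OF J] x y xy]) simp
  with x y show ?thesis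
    by (auto simp: w' colon_def split: bch_var.splits)
qed

end

section \<open>Baker--Campbell--Hausdorff coefficients of degree one and two\<close>

lemma bch_series_1: "bch_series [v] = 1"
  by (cases v) (simp_all add: bch_series_def nc_ln1p_def nc_mult_def nc_exp_def nc_var_def nc_one_def)

lemma bch_series_2:
  "bch_series [bch_var.X, bch_var.Y] = 1 / 2" "bch_series [bch_var.Y, bch_var.X] = - 1 / 2"
  by (simp_all add: bch_series_def nc_ln1p_def nc_mult_def nc_exp_def nc_var_def nc_one_def
      numeral_2_eq_2)

lemma finite_words: "finite {w :: bch_var list. w \<noteq> [] \<and> length w \<le> n}"
proof (rule finite_subset)
  show "finite {w. set w \<subseteq> {bch_var.X, bch_var.Y} \<and> length w \<le> n}"
    by (rule finite_lists_length_le) simp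
  show "{w :: bch_var list. w \<noteq> [] \<and> length w \<le> n} \<subseteq>
      {w. set w \<subseteq> {bch_var.X, bch_var.Y} \<and> length w \<le> n}"
    using bch_var.exhaust by blast
qed


section \<open>Ideals under the Malcev correspondence\<close>

locale malcev_group = G: group G + malcev_lie_algebra G L
  for G :: "('a, 'm) monoid_scheme" and L :: "(rat, 'a, 'n) module_scheme" (structure)
begin

lemma lie_lower_central_nilpotency_class: "lie_lower_central L (nilpotency_class L) = {\<zero>}"
  unfolding nilpotency_class_def using nilpotent by (rule LeastI_ex)

definition bch_term :: "'a \<Rightarrow> 'a \<Rightarrow> bch_var list \<Rightarrow> 'a" where
  "bch_term x y w = (bch_series w / of_nat (length w)) \<odot> nested_product L (case_bch_var x y) w"

lemma bch_term_closed: "x \<in> carrier L \<Longrightarrow> y \<in> carrier L \<Longrightarrow> bch_term x y w \<in> carrier L"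
  unfolding bch_term_def by (intro smult_closed nested_product_closed) (auto split: bch_var.splits)

text \<open>\<open>B\<close> collects the words whose terms are kept modulo \<open>I\<close>. It is
  chosen independently of the nilpotency class, so it is compared with the index set
  \<open>W\<close> of \<open>bch\<close> through their union.\<close>

lemma bch_cong:
  assumes I: "lie_ideal I" and x: "x \<in> carrier L" and y: "y \<in> carrier L"
    and B: "finite B" "[] \<notin> B"
    and nested: "\<And>w. w \<noteq> [] \<Longrightarrow> w \<notin> B \<Longrightarrow> nested_product L (case_bch_var x y) w \<in> I"
  shows "cong I (bch L x y) (finsum L (bch_term x y) B)"
proof -
  define W where "W = {w :: bch_var list. w \<noteq> [] \<and> length w \<le> nilpotency_class L}"
  have W: "finite W"
    unfolding W_def by (rule finite_words)
  have closed: "bch_term x y \<in> A \<rightarrow> carrier L" for A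
    using bch_term_closed[OF x y] by blast
  \<comment> \<open>Words of \<open>B\<close> that \<open>bch\<close> omits are longer than the
    nilpotency class, so their nested products vanish.\<close>
  have zero: "bch_term x y w = \<zero>" if "w \<in> B - W" for w
  proof -
    have "nilpotency_class L \<le> length w - 1" "w \<noteq> []"
      using that B by (auto simp: W_def)
    moreover from this have "nested_product L (case_bch_var x y) w \<in> lie_lower_central L (length w - 1)"
      using x y by (intro nested_product_lower_central) (auto split: bch_var.splits)
    ultimately have "nested_product L (case_bch_var x y) w \<in> {\<zero>}"
      using lie_lower_central_antimono lie_lower_central_nilpotency_class by blast
    then show ?thesis
      by (simp add: bch_term_def smult_r_null)
  qed
  have "finsum L (bch_term x y) (W \<union> (B - W)) =
      finsum L (bch_term x y) W \<oplus> finsum L (bch_term x y) (B - W)"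
    using W B closed by (intro M.finsum_Un_disjoint) auto
  also have "finsum L (bch_term x y) (B - W) = \<zero>"
    by (rule M.add.finprod_one_eqI) (use zero in auto)
  finally have 1: "finsum L (bch_term x y) (W \<union> B) = finsum L (bch_term x y) W"
    using closed by simp
  have "finsum L (bch_term x y) (B \<union> (W - B)) =
      finsum L (bch_term x y) B \<oplus> finsum L (bch_term x y) (W - B)"
    using W B closed by (intro M.finsum_Un_disjoint) auto
  moreover have "B \<union> (W - B) = W \<union> B"
    by blast
  moreover have "bch L x y = finsum L (bch_term x y) W"
    unfolding bch_def W_def bch_term_def ..
  moreover have "finsum L (bch_term x y) (W - B) \<in> I"
    using W nested lie_ideal_smult[OF I] by (intro lie_ideal_finsum[OF I]) (auto simp: bch_term_def W_def)
  ultimately show ?thesis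
    unfolding cong_iff_add using 1 closed by (auto intro!: bexI[of _ "finsum L (bch_term x y) (W - B)"])
qed

lemma bch_cong_add:
  assumes "lie_ideal I" and x: "x \<in> carrier L" and y: "y \<in> carrier L" and "x \<otimes> y \<in> I"
  shows "cong I (bch L x y) (x \<oplus> y)"
proof -
  have "cong I (bch L x y) (finsum L (bch_term x y) {[bch_var.X], [bch_var.Y]})"
  proof (rule bch_cong)
    fix w :: "bch_var list"
    assume "w \<noteq> []" "w \<notin> {[bch_var.X], [bch_var.Y]}"
    moreover from this have "w \<noteq> [u]" for u
      by (cases u) auto
    ultimately have "2 \<le> length w"
      by (cases w; cases "tl w") auto
    then show "nested_product L (case_bch_var x y) w \<in> I"
      using assms by (intro nested_product_in_ideal)
  qed (use assms in auto)
  moreover have "finsum L (bch_term x y) {[bch_var.X], [bch_var.Y]} = x \<oplus> y"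
    using x y by (simp add: bch_term_def bch_series_1)
  ultimately show ?thesis
    by simp
qed

text \<open>The second-order counterpart of \<open>bch_cong_add\<close>:
  \<open>x \<otimes> y\<close> is central modulo \<open>J\<close>, so brackets of three or more
  letters lie in \<open>J\<close>.\<close>

lemma bch_cong_add_half:
  assumes J: "lie_ideal J" and x: "x \<in> carrier L" and y: "y \<in> carrier L" and xy: "x \<otimes> y \<in> colon J"
  shows "cong J (bch L x y) (x \<oplus> y \<oplus> (1 / 2) \<odot> (x \<otimes> y))"
proof -
  define B where "B = {[bch_var.X], [bch_var.Y], [bch_var.X, bch_var.Y], [bch_var.Y, bch_var.X]}"
  have "cong J (bch L x y) (finsum L (bch_term x y) B)"
  proof (rule bch_cong)
    fix w :: "bch_var list"
    assume w: "w \<noteq> []" "w \<notin> B"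
    show "nested_product L (case_bch_var x y) w \<in> J"
    proof (cases "3 \<le> length w")
      case True
      with assms show ?thesis
        by (intro nested_product_in_ideal_colon)
    next
      case False
      with w obtain u v where "w = [u] \<or> w = [u, v]"
        by (cases w; cases "tl w") (auto simp: Suc_le_eq)
      with w x y lie_ideal_zero[OF J] show ?thesis
        by (cases u; cases v) (auto simp: B_def alternating)
    qed
  qed (use assms in \<open>auto simp: B_def\<close>)
  moreover have "finsum L (bch_term x y) B = x \<oplus> y \<oplus> (1 / 2) \<odot> (x \<otimes> y)"
  proof -
    have half: "(1 / 4) \<odot> z \<oplus> (1 / 4) \<odot> z = (1 / 2) \<odot> z" if "z \<in> carrier L" for z
      using smult_l_distr[of "1 / 4" "1 / 4" z] that by simp
    \<comment> \<open>The coefficients of degree two are divided by the word length 2. By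
      anticommutativity the words \<open>XY\<close> and \<open>YX\<close> each contribute a quarter
      of \<open>x \<otimes> y\<close>.\<close>
    have "(- (1 / 4)) \<odot> (y \<otimes> x) = (1 / 4) \<odot> (x \<otimes> y)"
      using x y smult_assoc1[of "1 / 4" "- 1" "y \<otimes> x"]
      by (simp add: anticommute[of x y] smult_minus_one prod_closed)
    then show ?thesis
      using x y half[of "x \<otimes> y"]
      by (simp add: B_def bch_term_def bch_series_1 bch_series_2 prod_closed M.a_assoc)
  qed
  ultimately show ?thesis
    by simp
qed

section \<open>Group operations and cosets in terms of the Lie algebra\<close>

lemma smult_of_int: "x \<in> carrier G \<Longrightarrow> of_int n \<odot> x = x [^]\<^bsub>G\<^esub> n"
  \<comment> \<open>An integer has denominator 1, so the root in \<open>rat_pow\<close> is a first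
    root and trivially unique.\<close>
  by (auto simp: smult_eq rat_pow_def intro!: the_equality)

lemma one_eq: "\<one>\<^bsub>G\<^esub> = \<zero>"
  using smult_of_int[of "\<one>\<^bsub>G\<^esub>" 0] G.one_closed by (simp flip: carrier_eq)

lemma inv_eq: "x \<in> carrier G \<Longrightarrow> inv\<^bsub>G\<^esub> x = \<ominus> x"
  using smult_of_int[of x "- 1"] smult_minus_one[of x] by (simp add: carrier_eq G.int_pow_neg)

lemma mult_cong_add:
  "lie_ideal I \<Longrightarrow> x \<in> carrier L \<Longrightarrow> y \<in> carrier L \<Longrightarrow> x \<otimes> y \<in> I \<Longrightarrow> cong I (x \<otimes>\<^bsub>G\<^esub> y) (x \<oplus> y)"
  using bch_cong_add[of I x y] bch_eq by (simp add: carrier_eq)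

text \<open>Additive and multiplicative cosets of an ideal coincide: if
  \<open>x = y \<oplus> s\<close> with \<open>s\<close> in \<open>I\<close>, the bracket of
  \<open>x\<close> with \<open>\<ominus> y\<close> is in \<open>I\<close> because
  \<open>y \<otimes> y\<close> vanishes. Conversely, a group factor from \<open>I\<close> has all
  its brackets in \<open>I\<close>, so multiplying by it amounts to adding it modulo
  \<open>I\<close>.\<close>

lemma cong_iff_mult_inv:
  assumes I: "lie_ideal I" and x: "x \<in> carrier L" and y: "y \<in> carrier L"
  shows "cong I x y \<longleftrightarrow> x \<otimes>\<^bsub>G\<^esub> inv\<^bsub>G\<^esub> y \<in> I"
proof
  assume "cong I x y"
  then obtain s where s: "s \<in> I" "s \<in> carrier L" "x = y \<oplus> s"
    by (auto simp: cong_iff_add)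
  have "x \<otimes> (\<ominus> y) = \<ominus> (s \<otimes> y)"
    using s y by (simp add: prod_add_left prod_minus_right prod_closed alternating M.minus_add)
  then have "x \<otimes> (\<ominus> y) \<in> I"
    using lie_ideal_minus[OF I] lie_ideal_prod_left[OF I] s y by simp
  then have "cong I (x \<otimes>\<^bsub>G\<^esub> \<ominus> y) (x \<oplus> \<ominus> y)"
    using x y by (intro mult_cong_add[OF I]) auto
  then have "cong I (x \<otimes>\<^bsub>G\<^esub> inv\<^bsub>G\<^esub> y) (x \<oplus> \<ominus> y)"
    using y by (simp add: inv_eq carrier_eq)
  moreover have "x \<oplus> \<ominus> y \<in> I"
    using \<open>cong I x y\<close> by (simp add: cong_def a_minus_def)
  ultimately show "x \<otimes>\<^bsub>G\<^esub> inv\<^bsub>G\<^esub> y \<in> I"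
    using cong_trans[OF I] cong_zero_iff[OF I] by blast
next
  define s where "s = x \<otimes>\<^bsub>G\<^esub> inv\<^bsub>G\<^esub> y"
  assume "x \<otimes>\<^bsub>G\<^esub> inv\<^bsub>G\<^esub> y \<in> I"
  then have s: "s \<in> I" "s \<in> carrier L"
    using lie_ideal_closed[OF I] by (simp_all add: s_def)
  have "s \<otimes>\<^bsub>G\<^esub> y = x"
    using x y by (simp add: s_def carrier_eq G.m_assoc)
  then have "cong I x (s \<oplus> y)"
    using mult_cong_add[OF I s(2) y] lie_ideal_prod_left[OF I s(1) y] by simp
  moreover have "cong I (s \<oplus> y) y"
    using s y by (auto simp: cong_iff_add M.a_comm)
  ultimately show "cong I x y"
    using cong_trans[OF I] by blast
qed

end

section \<open>Commutators, brackets and normal subgroups\<close>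

context malcev_group
begin

text \<open>
  If \<open>I\<close> contains the commutator, then \<open>x \<circ> g\<close> and \<open>g \<circ> x\<close> are congruent modulo \<open>I\<close>. The terms of
  degree at least 3 are removed one step of the lower central series at a time: every ideal
  \<open>J \<supseteq> I + L\<^sub>j\<close> contains \<open>x \<otimes> g\<close>, by induction on \<open>j\<close>, since the induction hypothesis for \<open>colon J\<close>
  puts the triple brackets into \<open>J\<close>.
\<close>

lemma commutator_mem_iff:
  assumes I: "lie_ideal I" and x: "x \<in> carrier L" and g: "g \<in> carrier L"
  shows "x \<otimes>\<^bsub>G\<^esub> g \<otimes>\<^bsub>G\<^esub> inv\<^bsub>G\<^esub> x \<otimes>\<^bsub>G\<^esub> inv\<^bsub>G\<^esub> g \<in> I \<longleftrightarrow> x \<otimes> g \<in> I"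
proof -
  have closed: "x \<otimes>\<^bsub>G\<^esub> g \<in> carrier L" "g \<otimes>\<^bsub>G\<^esub> x \<in> carrier L"
    using x g by (simp_all add: carrier_eq)
  have "x \<otimes>\<^bsub>G\<^esub> g \<otimes>\<^bsub>G\<^esub> inv\<^bsub>G\<^esub> x \<otimes>\<^bsub>G\<^esub> inv\<^bsub>G\<^esub> g = (x \<otimes>\<^bsub>G\<^esub> g) \<otimes>\<^bsub>G\<^esub> inv\<^bsub>G\<^esub> (g \<otimes>\<^bsub>G\<^esub> x)"
    using x g by (simp add: carrier_eq G.inv_mult_group G.m_assoc)
  then have "x \<otimes>\<^bsub>G\<^esub> g \<otimes>\<^bsub>G\<^esub> inv\<^bsub>G\<^esub> x \<otimes>\<^bsub>G\<^esub> inv\<^bsub>G\<^esub> g \<in> I \<longleftrightarrow> cong I (x \<otimes>\<^bsub>G\<^esub> g) (g \<otimes>\<^bsub>G\<^esub> x)"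
    using cong_iff_mult_inv[OF I closed] by simp
  also have "\<dots> \<longleftrightarrow> x \<otimes> g \<in> I"
  proof
    assume xg: "x \<otimes> g \<in> I"
    have "cong I (x \<otimes>\<^bsub>G\<^esub> g) (x \<oplus> g)"
      using I x g xg by (rule mult_cong_add)
    moreover have "cong I (g \<otimes>\<^bsub>G\<^esub> x) (x \<oplus> g)"
      using mult_cong_add[OF I g x lie_ideal_prod_commute[OF I x g xg]] x g by (simp add: M.a_comm)
    ultimately show "cong I (x \<otimes>\<^bsub>G\<^esub> g) (g \<otimes>\<^bsub>G\<^esub> x)"
      using cong_sym[OF I] cong_trans[OF I] by blast
  next
    assume cong: "cong I (x \<otimes>\<^bsub>G\<^esub> g) (g \<otimes>\<^bsub>G\<^esub> x)"
    have "x \<otimes> g \<in> J" if "lie_ideal J" "I \<subseteq> J" "lie_lower_central L j \<subseteq> J" for J j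
      using that
    proof (induction j arbitrary: J)
      case 0
      then show ?case
        using x g prod_closed by auto
    next
      case (Suc j)
      note J = \<open>lie_ideal J\<close>
      note [trans] = cong_trans[OF J]
      define z where "z = x \<otimes> g"
      have z: "z \<in> carrier L"
        using x g by (simp add: z_def prod_closed)
      have "I \<subseteq> colon J"
        using lie_ideal_closed[OF I] lie_ideal_prod_right[OF I] Suc.prems(2) by (auto simp: colon_def)
      moreover have "lie_lower_central L j \<subseteq> colon J"
        using lie_ideal_closed[OF lie_lower_central_ideal] prod_lie_lower_central Suc.prems(3)
        by (auto simp: colon_def)
      ultimately have xg: "x \<otimes> g \<in> colon J"
        using Suc.IH colon_ideal[OF J] by blast
      have gx: "g \<otimes> x \<in> colon J"
        using lie_ideal_prod_commute[OF colon_ideal[OF J] x g xg] .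
      have "cong J (x \<oplus> g \<oplus> (1 / 2) \<odot> z) (x \<otimes>\<^bsub>G\<^esub> g)"
        using cong_sym[OF J bch_cong_add_half[OF J x g xg]] bch_eq x g by (simp add: carrier_eq z_def)
      also have "cong J (x \<otimes>\<^bsub>G\<^esub> g) (g \<otimes>\<^bsub>G\<^esub> x)"
        using cong Suc.prems(2) by (auto simp: cong_def)
      also have "cong J (g \<otimes>\<^bsub>G\<^esub> x) (g \<oplus> x \<oplus> (1 / 2) \<odot> (g \<otimes> x))"
        using bch_cong_add_half[OF J g x gx] bch_eq x g by (simp add: carrier_eq)
      also have "g \<oplus> x \<oplus> (1 / 2) \<odot> (g \<otimes> x) = x \<oplus> g \<oplus> \<ominus> ((1 / 2) \<odot> z)"
        using x g z by (simp add: z_def anticommute[of g x] M.a_comm smult_r_minus prod_closed)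
      finally have "cong J (x \<oplus> g \<oplus> (1 / 2) \<odot> z) (x \<oplus> g \<oplus> \<ominus> ((1 / 2) \<odot> z))"
        .
      \<comment> \<open>The added element cancels \<open>x \<oplus> g\<close> and turns the two
        sides into \<open>z\<close> and \<open>\<zero>\<close>.\<close>
      from cong_add[OF J this cong_refl[OF J, of "\<ominus> (x \<oplus> g) \<oplus> (1 / 2) \<odot> z"]]
      have "cong J ((x \<oplus> g \<oplus> (1 / 2) \<odot> z) \<oplus> (\<ominus> (x \<oplus> g) \<oplus> (1 / 2) \<odot> z))
          ((x \<oplus> g \<oplus> \<ominus> ((1 / 2) \<odot> z)) \<oplus> (\<ominus> (x \<oplus> g) \<oplus> (1 / 2) \<odot> z))"
        using x g z by simp
      moreover have "(s \<oplus> h) \<oplus> (\<ominus> s \<oplus> h) = h \<oplus> h" "(s \<oplus> \<ominus> h) \<oplus> (\<ominus> s \<oplus> h) = \<zero>"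
        if "s \<in> carrier L" "h \<in> carrier L" for s h
        using that by (simp_all add: M.a_ac M.r_neg M.r_neg1 M.r_neg2)
      moreover have "(1 / 2) \<odot> z \<oplus> (1 / 2) \<odot> z = z"
        using smult_l_distr[of "1 / 2" "1 / 2" z] z by simp
      ultimately have "cong J z \<zero>"
        using x g z by simp
      then show ?case
        using cong_zero_iff[OF J] by (simp add: z_def)
    qed
    \<comment> \<open>At the nilpotency class the series is zero, so \<open>J = I\<close> is
      admissible.\<close>
    from this[OF I, of "nilpotency_class L"] show "x \<otimes> g \<in> I"
      using lie_ideal_zero[OF I] by (simp add: lie_lower_central_nilpotency_class)
  qed
  finally show ?thesis .
qed

text \<open>
  Downward induction on \<open>k\<close> shows that \<open>H \<inter> L\<^sub>k\<close> is an ideal: brackets of its elements lie in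
  \<open>H \<inter> L\<^bsub>k+1\<^esub>\<close>, modulo which products are sums.
\<close>

lemma normal_subgroup_imp_lie_ideal:
  assumes H: "H \<lhd> G" and smult: "\<And>q x. x \<in> H \<Longrightarrow> q \<odot> x \<in> H"
  shows "lie_ideal H"
proof -
  interpret H: normal H G
    by (rule H)
  have closed: "x \<in> carrier L" if "x \<in> H" for x
    using that H.subset carrier_eq by blast
  have "lie_ideal (H \<inter> lie_lower_central L k)" if "k \<le> nilpotency_class L" for k
    using that
  proof (induction rule: inc_induct)
    case base
    have "H \<inter> lie_lower_central L (nilpotency_class L) = lie_lower_central L (nilpotency_class L)"
      using H.one_closed by (simp add: lie_lower_central_nilpotency_class one_eq)
    with lie_lower_central_ideal show ?case
      by simp
  next
    case (step k)
    define S where "S = H \<inter> lie_lower_central L (Suc k)"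
    have S: "lie_ideal S"
      unfolding S_def by (rule step.IH)
    have prod: "x \<otimes> g \<in> S" "g \<otimes> x \<in> S"
      if x: "x \<in> H" "x \<in> lie_lower_central L k" and g: "g \<in> carrier L" for x g
    proof -
      have "x \<otimes> g \<in> lie_lower_central L (Suc k)"
        using lie_ideal_prod_commute[OF lie_lower_central_ideal g closed prod_lie_lower_central] x g by blast
      then have "x \<otimes>\<^bsub>G\<^esub> g \<otimes>\<^bsub>G\<^esub> inv\<^bsub>G\<^esub> x \<otimes>\<^bsub>G\<^esub> inv\<^bsub>G\<^esub> g \<in> lie_lower_central L (Suc k)"
        using commutator_mem_iff[OF lie_lower_central_ideal closed g] x by blast
      \<comment> \<open>Bracketed this way, the commutator is \<open>x\<close> times a conjugate of
        its inverse, and normality applies.\<close>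
      moreover have "x \<otimes>\<^bsub>G\<^esub> (g \<otimes>\<^bsub>G\<^esub> inv\<^bsub>G\<^esub> x \<otimes>\<^bsub>G\<^esub> inv\<^bsub>G\<^esub> g) \<in> H"
        using x g by (intro H.m_closed H.inv_op_closed2 H.m_inv_closed) (simp_all add: carrier_eq)
      then have "x \<otimes>\<^bsub>G\<^esub> g \<otimes>\<^bsub>G\<^esub> inv\<^bsub>G\<^esub> x \<otimes>\<^bsub>G\<^esub> inv\<^bsub>G\<^esub> g \<in> H"
        using x g H.mem_carrier by (simp add: carrier_eq G.m_assoc)
      ultimately have "x \<otimes>\<^bsub>G\<^esub> g \<otimes>\<^bsub>G\<^esub> inv\<^bsub>G\<^esub> x \<otimes>\<^bsub>G\<^esub> inv\<^bsub>G\<^esub> g \<in> S"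
        unfolding S_def by blast
      then show "x \<otimes> g \<in> S"
        using commutator_mem_iff[OF S closed g] x by blast
      then show "g \<otimes> x \<in> S"
        using lie_ideal_prod_commute[OF S closed g] x by blast
    qed
    have add: "x \<oplus> y \<in> H" if x: "x \<in> H" "x \<in> lie_lower_central L k" and y: "y \<in> H" for x y
    proof -
      \<comment> \<open>Sum and product differ by a group factor from \<open>S\<close>, which lies
        in \<open>H\<close>; multiplying it by the product, also in \<open>H\<close>, recovers the
        sum.\<close>
      have "cong S (x \<oplus> y) (x \<otimes>\<^bsub>G\<^esub> y)"
        using mult_cong_add[OF S closed closed prod(1)] cong_sym[OF S] x y closed by blast
      then have "(x \<oplus> y) \<otimes>\<^bsub>G\<^esub> inv\<^bsub>G\<^esub> (x \<otimes>\<^bsub>G\<^esub> y) \<in> H"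
        using cong_iff_mult_inv[OF S] unfolding cong_def S_def by blast
      from H.m_closed[OF this H.m_closed[OF x(1) y]] show ?thesis
        using x y closed M.a_closed[of x y] by (simp add: carrier_eq G.m_assoc)
    qed
    note Lk = lie_lower_central_ideal[of k]
    have "S \<subseteq> H \<inter> lie_lower_central L k"
      using lie_lower_central_Suc by (auto simp: S_def)
    with prod show ?case
      using closed add smult lie_ideal_add[OF Lk] lie_ideal_smult[OF Lk] lie_ideal_zero[OF S]
      by (intro lie_idealI) auto
  qed
  from this[of 0] show ?thesis
    using H.subset by (simp add: carrier_eq Int_absorb2)
qed

text \<open>The fraction need not be in lowest terms, unlike in \<open>rat_pow\<close>: scalars
  compose, and integer scalars are integer powers.\<close>

lemma smult_pow:
  assumes "x \<in> carrier L" "0 < n"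
  shows "((of_int m / of_nat n) \<odot> x) [^]\<^bsub>G\<^esub> (n::nat) = x [^]\<^bsub>G\<^esub> (m::int)"
proof -
  have "((of_int m / of_nat n) \<odot> x) [^]\<^bsub>G\<^esub> int n = of_int (int n) \<odot> ((of_int m / of_nat n) \<odot> x)"
    using assms smult_closed[of "of_int m / of_nat n" x] by (subst smult_of_int) (simp_all add: carrier_eq)
  also have "\<dots> = of_int m \<odot> x"
    using smult_assoc1[of "of_int (int n)" "of_int m / of_nat n" x] assms by simp
  also have "\<dots> = x [^]\<^bsub>G\<^esub> m"
    using assms by (simp add: smult_of_int carrier_eq)
  finally show ?thesis
    by (simp add: int_pow_int)
qed

end

lemma rat_fraction:
  fixes q :: rat
  obtains m :: int and n :: nat where "q = of_int m / of_nat n" "0 < n"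
proof (cases q)
  case (Fract a b)
  with that[of a "nat b"] show ?thesis
    by (simp add: Fract_of_int_quotient)
qed

section \<open>The order on the Malcev Lie algebra\<close>

locale ordered_malcev_group = G: linearly_ordered_nilpotent_group G r + malcev_group G L
  for G :: "('a, 'm) monoid_scheme" and r and L :: "(rat, 'a, 'n) module_scheme" (structure)
begin

text \<open>A subgroup closed under roots is closed under rational powers, which are the scalar
  multiples.\<close>

lemma infinitesimal_ideal:
  assumes "G.less \<one>\<^bsub>G\<^esub> d"
  shows "lie_ideal (G.infinitesimal d)"
proof (rule normal_subgroup_imp_lie_ideal[OF G.infinitesimal_normal[OF assms]])
  fix q :: rat and x
  assume x: "x \<in> G.infinitesimal d"
  then have xL: "x \<in> carrier L"
    by (simp add: carrier_eq G.infinitesimal_closed)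
  obtain m n where q: "q = of_int m / of_nat n" "0 < n"
    by (rule rat_fraction[of q])
  have "(q \<odot> x) [^]\<^bsub>G\<^esub> n \<in> G.infinitesimal d"
    using G.subgroup_int_pow_closed[OF G.infinitesimal_subgroup[OF assms] x]
    unfolding q(1) smult_pow[OF xL q(2)] .
  then show "q \<odot> x \<in> G.infinitesimal d"
    by (rule G.infinitesimal_root) (use q(2) smult_closed[of q x] xL in \<open>auto simp: carrier_eq\<close>)
qed

lemma prod_infinitesimal:
  assumes d: "G.less \<one>\<^bsub>G\<^esub> d" and g: "g \<in> carrier L"
  shows "g \<otimes> d \<in> G.infinitesimal d" "d \<otimes> g \<in> G.infinitesimal d"
proof -
  have dL: "d \<in> carrier L"
    using G.less_closed[OF d] by (simp add: carrier_eq)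
  show "g \<otimes> d \<in> G.infinitesimal d"
    using G.commutator_infinitesimal[OF d] commutator_mem_iff[OF infinitesimal_ideal[OF d] g dL] g
    by (simp add: G.conjugate_def carrier_eq)
  then show "d \<otimes> g \<in> G.infinitesimal d"
    using lie_ideal_prod_commute[OF infinitesimal_ideal[OF d]] g dL by blast
qed

lemma add_mono:
  assumes ab: "(a, b) \<in> r" and c: "c \<in> carrier L"
  shows "(a \<oplus> c, b \<oplus> c) \<in> r"
proof (cases "a = b")
  case True
  with assms show ?thesis
    using G.le_closed M.a_closed[of b c] G.le_refl by (simp add: carrier_eq)
next
  case False
  have a: "a \<in> carrier L" and b: "b \<in> carrier L"
    using G.le_closed[OF ab] by (simp_all add: carrier_eq)
  define d where "d = b \<otimes>\<^bsub>G\<^esub> inv\<^bsub>G\<^esub> a"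
  define I where "I = G.infinitesimal d"
  have d: "G.less \<one>\<^bsub>G\<^esub> d"
    using G.less_mult_right[of a b "inv\<^bsub>G\<^esub> a"] ab False a by (simp add: G.less_def d_def carrier_eq)
  then have dL: "d \<in> carrier L"
    using G.less_closed[OF d] by (simp add: carrier_eq)
  have I: "lie_ideal I"
    unfolding I_def by (rule infinitesimal_ideal[OF d])
  have ac: "a \<oplus> c \<in> carrier L" and bc: "b \<oplus> c \<in> carrier L"
    using a b c by simp_all
  have dac: "d \<otimes>\<^bsub>G\<^esub> (a \<oplus> c) \<in> carrier L"
    using dL ac by (simp add: carrier_eq)
  \<comment> \<open>Brackets with \<open>d\<close> lie in \<open>I\<close>, so modulo
    \<open>I\<close> left multiplication by \<open>d\<close> is addition of
    \<open>d\<close>.\<close>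
  have mult_cong: "cong I (d \<otimes>\<^bsub>G\<^esub> x) (d \<oplus> x)" if "x \<in> carrier L" for x
    using that prod_infinitesimal(2)[OF d that] by (intro mult_cong_add[OF I dL]) (simp_all add: I_def)
  have "d \<otimes>\<^bsub>G\<^esub> a = b"
    using a b by (simp add: d_def carrier_eq G.m_assoc)
  with mult_cong[OF a] have "cong I b (d \<oplus> a)"
    by simp
  from cong_add[OF I this cong_refl[OF I c]] have "cong I (b \<oplus> c) (d \<oplus> (a \<oplus> c))"
    using a c dL by (simp add: M.a_assoc)
  then have "cong I (b \<oplus> c) (d \<otimes>\<^bsub>G\<^esub> (a \<oplus> c))"
    using cong_trans[OF I] cong_sym[OF I] mult_cong[OF ac] by blast
  then have z: "(b \<oplus> c) \<otimes>\<^bsub>G\<^esub> inv\<^bsub>G\<^esub> (d \<otimes>\<^bsub>G\<^esub> (a \<oplus> c)) \<in> I"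
    using cong_iff_mult_inv[OF I bc dac] by simp
  define z where "z = (b \<oplus> c) \<otimes>\<^bsub>G\<^esub> inv\<^bsub>G\<^esub> (d \<otimes>\<^bsub>G\<^esub> (a \<oplus> c))"
  have zG: "z \<in> carrier G"
    using z lie_ideal_closed[OF I] by (simp add: z_def carrier_eq)
  \<comment> \<open>The infinitesimal error \<open>z\<close> cannot outweigh \<open>d\<close>, so
    the total factor from \<open>a \<oplus> c\<close> to \<open>b \<oplus> c\<close> still exceeds
    the identity.\<close>
  have "G.less (inv\<^bsub>G\<^esub> z) d"
    using z by (simp add: z_def I_def G.infinitesimal_inv G.infinitesimal_less)
  from G.less_mult_left[OF this zG] have "G.less \<one>\<^bsub>G\<^esub> (z \<otimes>\<^bsub>G\<^esub> d)"
    using zG by simp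
  from G.less_mult_right[OF this] have "G.less (a \<oplus> c) (z \<otimes>\<^bsub>G\<^esub> d \<otimes>\<^bsub>G\<^esub> (a \<oplus> c))"
    using ac by (simp add: carrier_eq)
  also have "z \<otimes>\<^bsub>G\<^esub> d \<otimes>\<^bsub>G\<^esub> (a \<oplus> c) = z \<otimes>\<^bsub>G\<^esub> (d \<otimes>\<^bsub>G\<^esub> (a \<oplus> c))"
    using zG dL ac by (simp add: carrier_eq G.m_assoc)
  also have "\<dots> = b \<oplus> c"
    using bc dac by (simp add: z_def carrier_eq G.m_assoc)
  finally show ?thesis
    by (rule G.less_imp_le)
qed

text \<open>For \<open>q = m / n\<close> the \<open>n\<close>-th powers of the two sides are the
  \<open>m\<close>-th powers of \<open>a\<close> and \<open>b\<close>, and taking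
  \<open>n\<close>-th powers reflects the order.\<close>

lemma smult_mono:
  assumes ab: "(a, b) \<in> r" and "0 \<le> q"
  shows "(q \<odot> a, q \<odot> b) \<in> r"
proof -
  have L: "a \<in> carrier L" "b \<in> carrier L"
    using G.le_closed[OF ab] by (simp_all add: carrier_eq)
  obtain m n where q: "q = of_int m / of_nat n" "0 < n"
    by (rule rat_fraction[of q])
  with \<open>0 \<le> q\<close> have "0 \<le> m"
    by (simp add: zero_le_divide_iff)
  then have "((q \<odot> a) [^]\<^bsub>G\<^esub> n, (q \<odot> b) [^]\<^bsub>G\<^esub> n) \<in> r"
    unfolding q(1) smult_pow[OF L(1) q(2)] smult_pow[OF L(2) q(2)]
    using G.pow_mono[OF ab, of "nat m"] by (simp add: pow_nat)
  then show ?thesis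
    by (rule G.pow_le_imp_le) (use q(2) L smult_closed[of q] in \<open>auto simp: carrier_eq\<close>)
qed

theorem linearly_ordered_algebra: "linearly_ordered_algebra L r"
proof (intro linearly_ordered_algebra.intro linearly_ordered_algebra_axioms.intro)
  show "algebra_over_field L"
    by (rule algebra_over_field_axioms)
  show "linear_order_on (carrier L) r"
    using G.linear_order by (simp add: carrier_eq)
  fix a b
  assume "(\<zero>, a) \<in> r" "a \<noteq> \<zero>" and b: "b \<in> carrier L"
  then have "G.less \<one>\<^bsub>G\<^esub> a"
    by (simp add: G.less_def one_eq)
  from prod_infinitesimal[OF this b] show "(a \<otimes> b, a) \<in> r \<and> a \<otimes> b \<noteq> a \<and> (b \<otimes> a, a) \<in> r \<and> b \<otimes> a \<noteq> a"
    by (auto dest!: G.infinitesimal_less simp: G.less_def)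
qed (rule add_mono smult_mono; assumption)+

end

theorem theorem3p16:
  fixes G :: "('a, 'm) monoid_scheme" and L :: "(rat, 'a, 'n) module_scheme" and r :: "'a rel"
  assumes "linearly_ordered_group G r"
    and "nilpotent_group G"
    and "divisible_group G"
    and "malcev_lie_algebra G L"
  shows "linearly_ordered_algebra L r"
proof -
  interpret ordered_malcev_group G r L
    using assms
    by (intro ordered_malcev_group.intro linearly_ordered_nilpotent_group.intro malcev_group.intro
        linearly_ordered_group.axioms)
  show ?thesis
    by (rule linearly_ordered_algebra)
qed

end
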